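(* The Poisson rounding scheme is convex when player valuations are matroid rank sum functions. That is, for all $n,m$ and all matroid rank sum functions $v_1,\dots,v_n:2^{[m]}\to\mathbb{R}_{\ge 0}$, the function $$x\ \mapsto\ \mathbf{E}_{(S_1,\dots,S_n)\sim r_{\mathrm{poiss}}(x)}\Big[\sum_{i=1}^n v_i(S_i)\Big]$$ is a concave function of $x\in\mathcal{R}$, where $\mathcal{R}=\{x\in[0,1]^{n\times m}:\sum_{i}x_{ij}\le 1\text{ for all } j\in[m]\}$.
   Context: An allocation of items $[m]=\{1,\dots,m\}$ to players $[n]=\{1,\dots,n\}$ is a tuple $(S_1,\dots,S_n)$ of pairwise disjoint subsets of $[m]$. The Poisson rounding scheme $r_{\mathrm{poiss}}$ maps each $x\in\mathcal{R}$ to a random allocation: independently for each item $j$, assign $j$ to player $i$ with probability $1-e^{-x_{ij}}$ (for each $i\in[n]$), and leave $j$ unassigned with the remaining probability $1-\sum_i(1-e^{-x_{ij}})\ge 0$. A set function $v:2^{[m]}\to\mathbb{R}_{\ge 0}$ is a matroid rank sum function if there are matroid rank functions $u_1,\dots,u_\kappa:2^{[m]}\to\mathbb{N}$ (of matroids on ground set $[m]$) and weights $w_1,\dots,w_\kappa\ge 0$ with $v(S)=\sum_{\ell=1}^\kappa w_\ell u_\ell(S)$ for all $S\subseteq[m]$. *)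

theory Defs
  imports "HOL-Probability.Probability" "HOL-Probability.Product_PMF"
begin

text \<open>
  Players are the elements of a finite type \<open>'n\<close> (so \<open>n = CARD('n)\<close>) and items the elements of a
  finite type \<open>'m\<close> (so \<open>m = CARD('m)\<close>); the fractional assignment \<open>x\<^bsub>ij\<^esub>\<close> is \<open>x $ i $ j\<close>.
\<close>

definition matroid :: "'a set \<Rightarrow> 'a set set \<Rightarrow> bool" where
  "matroid E \<I> \<longleftrightarrow>
     finite E \<and> \<I> \<subseteq> Pow E \<and> {} \<in> \<I> \<and>
     (\<forall>X\<in>\<I>. \<forall>Y. Y \<subseteq> X \<longrightarrow> Y \<in> \<I>) \<and>
     (\<forall>X\<in>\<I>. \<forall>Y\<in>\<I>. card X < card Y \<longrightarrow> (\<exists>e\<in>Y - X. insert e X \<in> \<I>))"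

definition matroid_rank :: "'a set set \<Rightarrow> 'a set \<Rightarrow> nat" where
  "matroid_rank \<I> S = Max (card ` {X \<in> \<I>. X \<subseteq> S})"

definition matroid_rank_function :: "'a set \<Rightarrow> ('a set \<Rightarrow> nat) \<Rightarrow> bool" where
  "matroid_rank_function E u \<longleftrightarrow>
     (\<exists>\<I>. matroid E \<I> \<and> (\<forall>S. S \<subseteq> E \<longrightarrow> u S = matroid_rank \<I> S))"

definition matroid_rank_sum :: "'a set \<Rightarrow> ('a set \<Rightarrow> real) \<Rightarrow> bool" where
  "matroid_rank_sum E v \<longleftrightarrow>
     (\<exists>(\<kappa>::nat) (u :: nat \<Rightarrow> 'a set \<Rightarrow> nat) (w :: nat \<Rightarrow> real).
        (\<forall>l<\<kappa>. matroid_rank_function E (u l) \<and> 0 \<le> w l) \<and>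
        (\<forall>S. S \<subseteq> E \<longrightarrow> v S = (\<Sum>l<\<kappa>. w l * real (u l S))))"

definition fractional_allocations :: "(real ^ 'm ^ 'n) set" where
  "fractional_allocations =
     {x. (\<forall>i j. 0 \<le> x $ i $ j \<and> x $ i $ j \<le> 1) \<and> (\<forall>j. (\<Sum>i\<in>UNIV. x $ i $ j) \<le> 1)}"

text \<open>
  The recipient of item \<open>j\<close>: \<open>Some i\<close> if it goes to player \<open>i\<close>, \<open>None\<close> if it stays unassigned.
  Outside \<^const>\<open>fractional_allocations\<close> the weights need not be a probability mass function, and
  \<^const>\<open>embed_pmf\<close> is then unspecified; see \<open>pmf_poisson_item\<close> below.
\<close>

definition poisson_item :: "real ^ 'm ^ 'n \<Rightarrow> 'm \<Rightarrow> 'n option pmf" where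
  "poisson_item x j = embed_pmf (\<lambda>a. case a of
       Some i \<Rightarrow> 1 - exp (- (x $ i $ j))
     | None \<Rightarrow> 1 - (\<Sum>i\<in>UNIV. 1 - exp (- (x $ i $ j))))"

definition poisson_rounding :: "real ^ 'm ^ 'n \<Rightarrow> ('n \<Rightarrow> 'm set) pmf" where
  "poisson_rounding x =
     map_pmf (\<lambda>\<sigma> i. {j. \<sigma> j = Some i}) (Pi_pmf UNIV None (poisson_item x))"

lemma pmf_poisson_item:
  fixes x :: "real ^ 'm ^ 'n"
  assumes "x \<in> fractional_allocations"
  shows "pmf (poisson_item x j) (Some i) = 1 - exp (- (x $ i $ j))"
    and "pmf (poisson_item x j) None = 1 - (\<Sum>i\<in>UNIV. 1 - exp (- (x $ i $ j)))"
proof -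
  define p where "p = (\<lambda>a. case a of
       Some i \<Rightarrow> 1 - exp (- (x $ i $ j))
     | None \<Rightarrow> 1 - (\<Sum>i\<in>UNIV. 1 - exp (- (x $ i $ j))))"
  have le: "1 - exp (- (x $ i $ j)) \<le> x $ i $ j" for i
    using exp_ge_add_one_self[of "- (x $ i $ j)"] by simp
  have "(\<Sum>i\<in>UNIV. 1 - exp (- (x $ i $ j))) \<le> (\<Sum>i\<in>UNIV. x $ i $ j)"
    by (rule sum_mono) (rule le)
  also have "\<dots> \<le> 1"
    using assms by (simp add: fractional_allocations_def)
  finally have nonneg: "0 \<le> p a" for a
    using assms by (auto simp: p_def fractional_allocations_def split: option.split)
  have total: "(\<Sum>a\<in>UNIV. p a) = 1"
    by (simp add: p_def UNIV_option_conv sum.reindex)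
  have "(\<integral>\<^sup>+ a. ennreal (p a) \<partial>count_space UNIV) = 1"
    using nonneg total by (simp add: nn_integral_count_space_finite)
  then have "pmf (poisson_item x j) a = p a" for a
    unfolding poisson_item_def p_def[symmetric] by (intro pmf_embed_pmf nonneg)
  then show "pmf (poisson_item x j) (Some i) = 1 - exp (- (x $ i $ j))"
    and "pmf (poisson_item x j) None = 1 - (\<Sum>i\<in>UNIV. 1 - exp (- (x $ i $ j)))"
    by (simp_all add: p_def)
qed

lemma disjoint_family_poisson_rounding:
  assumes "S \<in> set_pmf (poisson_rounding x)"
  shows "disjoint_family S"
  using assms by (auto simp: poisson_rounding_def disjoint_family_on_def)

end

theory Submission
  imports Defs
begin

text \<open>
  Under Poisson rounding with rates \<open>x\<close>, a set \<open>S\<close> won by one player behaves like a Markov chain: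
  differentiating the expectation of \<open>h S\<close> in direction \<open>d\<close> gives the expectation of
  \<open>\<Sum>i. d i * (h (S \<union> {i}) - h S)\<close>.
  Applying this twice, the second derivative along a line is the expectation of a quadratic form in
  \<open>d\<close> whose coefficients are the second differences of \<open>h\<close> at \<open>S\<close>. If \<open>h\<close> is a matroid rank
  function, a second difference is \<open>-1\<close> when the two items are parallel non-loops of the contraction
  by \<open>S\<close>, and \<open>0\<close> otherwise. Being parallel is an equivalence relation, so the form is minus
  a sum of squares, one for each parallel class.
\<close>

section \<open>Matroid rank functions\<close>

lemma finite_independent_subsets:
  assumes "matroid E \<I>"
  shows "finite {X \<in> \<I>. X \<subseteq> S}"
proof (rule finite_subset)
  show "{X \<in> \<I>. X \<subseteq> S} \<subseteq> Pow E"
    using assms by (auto simp: matroid_def)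
qed (use assms in \<open>auto simp: matroid_def\<close>)

lemma card_le_matroid_rank:
  assumes "matroid E \<I>" "X \<in> \<I>" "X \<subseteq> S"
  shows "card X \<le> matroid_rank \<I> S"
  unfolding matroid_rank_def
  using assms finite_independent_subsets[OF assms(1)] by (intro Max_ge) auto

lemma matroid_rank_attained:
  assumes "matroid E \<I>"
  obtains X where "X \<in> \<I>" "X \<subseteq> S" "card X = matroid_rank \<I> S"
proof -
  have "{X \<in> \<I>. X \<subseteq> S} \<noteq> {}"
    using assms by (auto simp: matroid_def)
  then have "matroid_rank \<I> S \<in> card ` {X \<in> \<I>. X \<subseteq> S}"
    unfolding matroid_rank_def
    using finite_independent_subsets[OF assms] by (intro Max_in) auto
  with that show ?thesis
    by auto
qed

lemma matroid_independent_subset: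
  "matroid E \<I> \<Longrightarrow> X \<in> \<I> \<Longrightarrow> Y \<subseteq> X \<Longrightarrow> Y \<in> \<I>"
  by (auto simp: matroid_def)

lemma matroid_independent_finite:
  "matroid E \<I> \<Longrightarrow> X \<in> \<I> \<Longrightarrow> finite X"
  by (auto simp: matroid_def dest: finite_subset)

lemma matroid_augment_within:
  assumes "matroid E \<I>" "Y \<in> \<I>" "card Y < matroid_rank \<I> T"
  obtains e where "e \<in> T - Y" "insert e Y \<in> \<I>"
proof -
  obtain X where X: "X \<in> \<I>" "X \<subseteq> T" "card X = matroid_rank \<I> T"
    using assms(1) by (rule matroid_rank_attained)
  with assms have "\<exists>e\<in>X - Y. insert e Y \<in> \<I>"
    by (simp add: matroid_def)
  with X that show ?thesis
    by blast
qed

lemma matroid_rank_mono: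
  assumes "matroid E \<I>" "S \<subseteq> T"
  shows "matroid_rank \<I> S \<le> matroid_rank \<I> T"
  using assms by (metis card_le_matroid_rank matroid_rank_attained subset_trans)

lemma matroid_rank_insert_le:
  assumes "matroid E \<I>"
  shows "matroid_rank \<I> (insert e S) \<le> Suc (matroid_rank \<I> S)"
proof -
  obtain X where X: "X \<in> \<I>" "X \<subseteq> insert e S" "card X = matroid_rank \<I> (insert e S)"
    using assms by (rule matroid_rank_attained)
  have "X - {e} \<in> \<I>"
    using assms X(1) by (rule matroid_independent_subset) blast
  then have "card (X - {e}) \<le> matroid_rank \<I> S"
    using X(2) by (intro card_le_matroid_rank[OF assms]) auto
  then show ?thesis
    using X(3) card_Diff1_le[of X e] by (cases "e \<in> X") (auto simp: card_Diff_singleton)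
qed

text \<open>Local submodularity. If \<open>i\<close> raises the rank of \<open>S\<close>, the bound
  holds because one element adds at most 1. Otherwise extend a maximum independent subset
  \<open>X\<close> of \<open>S\<close> to a maximum one \<open>Y\<close> of
  \<open>insert j S\<close>: if \<open>i\<close> raised the rank of \<open>insert j S\<close>, then
  \<open>insert i Y\<close> and hence \<open>insert i X\<close> would be independent, which is too
  large for \<open>insert i S\<close>.\<close>

lemma matroid_rank_insert_insert:
  assumes \<I>: "matroid E \<I>"
  shows "matroid_rank \<I> (insert i (insert j S)) + matroid_rank \<I> S
       \<le> matroid_rank \<I> (insert i S) + matroid_rank \<I> (insert j S)"
    (is "?r (insert i (insert j S)) + _ \<le> _")
proof (cases "?r (insert i S) = Suc (?r S)")
  case True
  then show ?thesis
    using matroid_rank_insert_le[OF \<I>, of i "insert j S"] by simp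
next
  case False
  then have i: "?r (insert i S) = ?r S"
    using matroid_rank_insert_le[OF \<I>, of i S] matroid_rank_mono[OF \<I>, of S "insert i S"]
    by (simp add: le_Suc_eq subset_insertI)
  obtain X where X: "X \<in> \<I>" "X \<subseteq> S" "card X = ?r S"
    using \<I> by (rule matroid_rank_attained)
  have "\<exists>Y\<in>\<I>. X \<subseteq> Y \<and> Y \<subseteq> insert j S \<and> card Y = ?r (insert j S)"
  proof (cases "?r (insert j S) = ?r S")
    case True
    with X show ?thesis by auto
  next
    case False
    then have j: "?r (insert j S) = Suc (?r S)"
      using matroid_rank_insert_le[OF \<I>, of j S] matroid_rank_mono[OF \<I>, of S "insert j S"]
      by (simp add: le_Suc_eq subset_insertI)
    with X obtain e where "e \<in> insert j S - X" "insert e X \<in> \<I>"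
      using \<I> by (metis lessI matroid_augment_within)
    with X j matroid_independent_finite[OF \<I> X(1)] show ?thesis
      by (intro bexI[of _ "insert e X"]) auto
  qed
  then obtain Y where Y: "Y \<in> \<I>" "X \<subseteq> Y" "Y \<subseteq> insert j S" "card Y = ?r (insert j S)"
    by blast
  have "?r (insert i (insert j S)) \<le> ?r (insert j S)"
  proof (rule ccontr)
    assume "\<not> ?thesis"
    then obtain e where e: "e \<in> insert i (insert j S) - Y" "insert e Y \<in> \<I>"
      using matroid_augment_within[OF \<I> Y(1)] Y(4) by (metis not_le)
    \<comment> \<open>\<open>insert e Y\<close> is too large to lie inside
      \<open>insert j S\<close>, so the new element can only be \<open>i\<close>.\<close>
    have "\<not> insert e Y \<subseteq> insert j S"
      using card_le_matroid_rank[OF \<I> e(2), of "insert j S"] Y(4) e(1)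
        matroid_independent_finite[OF \<I> Y(1)] by auto
    with e Y(3) have "e = i"
      by auto
    have "insert i X \<in> \<I>"
      using matroid_independent_subset[OF \<I> e(2)] Y(2) \<open>e = i\<close> by blast
    then have "card (insert i X) \<le> ?r (insert i S)"
      using X(2) by (intro card_le_matroid_rank[OF \<I>]) auto
    moreover have "i \<notin> X"
      using e(1) Y(2) \<open>e = i\<close> by auto
    ultimately show False
      using i X matroid_independent_finite[OF \<I> X(1)] by simp
  qed
  with i show ?thesis
    by simp
qed

section \<open>Second differences\<close>

definition directional_difference ::
  "('m::finite \<Rightarrow> real) \<Rightarrow> ('m set \<Rightarrow> real) \<Rightarrow> 'm set \<Rightarrow> real" where
  "directional_difference d h S = (\<Sum>i\<in>UNIV. d i * (h (insert i S) - h S))"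

text \<open>Exposes the iterated operator as a quadratic form in \<open>d\<close>, so that its sign
  can be read off from the second differences. The diagonal terms \<open>i = j\<close> reduce to
  \<open>- (h (insert i S) - h S)\<close>.\<close>

lemma directional_difference_twice:
  "directional_difference d (directional_difference d h) S =
     (\<Sum>i\<in>UNIV. \<Sum>j\<in>UNIV. d i * d j *
        (h (insert j (insert i S)) - h (insert i S) - h (insert j S) + h S))"
  unfolding directional_difference_def
  by (simp add: sum_subtractf[symmetric] sum_distrib_left algebra_simps)

lemma directional_difference_sum:
  "directional_difference d (\<lambda>S. \<Sum>l\<in>L. w l * h l S) S =
     (\<Sum>l\<in>L. w l * directional_difference d (h l) S)"
  unfolding directional_difference_def sum_subtractf[symmetric] sum_distrib_left
  by (subst sum.swap) (simp add: algebra_simps)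

text \<open>Grouping by the fibres of \<open>c\<close> leaves, for each value of \<open>c\<close>,
  the square of the total of \<open>d\<close> on its fibre.\<close>

lemma kernel_quadratic_form_nonneg:
  fixes d :: "'a \<Rightarrow> real" and c :: "'a \<Rightarrow> 'b"
  assumes "finite A"
  shows "0 \<le> (\<Sum>i\<in>A. \<Sum>j\<in>A. if c i = c j then d i * d j else 0)"
proof -
  define D where "D C = (\<Sum>j\<in>{j\<in>A. c j = C}. d j)" for C
  have "(\<Sum>i\<in>A. \<Sum>j\<in>A. if c i = c j then d i * d j else 0) = (\<Sum>i\<in>A. d i * D (c i))"
    unfolding D_def sum_distrib_left
    using assms by (auto simp: sum.inter_filter intro!: sum.cong)
  also have "\<dots> = (\<Sum>C\<in>c ` A. \<Sum>i\<in>{i\<in>A. c i = C}. d i * D (c i))"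
    using assms by (rule sum.image_gen)
  also have "\<dots> = (\<Sum>C\<in>c ` A. D C * D C)"
    unfolding D_def sum_distrib_right by (intro sum.cong refl) auto
  finally show ?thesis
    by (simp add: sum_nonneg)
qed

lemma directional_difference_twice_matroid_rank_nonpos:
  fixes d :: "'m::finite \<Rightarrow> real"
  assumes \<I>: "matroid UNIV \<I>"
  shows "directional_difference d (directional_difference d (\<lambda>S. real (matroid_rank \<I> S))) S \<le> 0"
proof -
  let ?r = "matroid_rank \<I>"
  \<comment> \<open>\<open>A\<close> holds the non-loops of the contraction by \<open>S\<close>, and
    \<open>cl i\<close> is the closure of \<open>insert i S\<close>. For elements of
    \<open>A\<close>, being parallel means having equal closures, so the parallel classes are the
    fibres of \<open>cl\<close>.\<close>
  define A where "A = {i. ?r (insert i S) = Suc (?r S)}"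
  define cl where "cl i = {k. ?r (insert k (insert i S)) = ?r (insert i S)}" for i
  have mono: "?r T \<le> ?r (insert k T)" for k T
    by (intro matroid_rank_mono[OF \<I>]) auto
  note step = matroid_rank_insert_le[OF \<I>]
  note submod = matroid_rank_insert_insert[OF \<I>]
  \<comment> \<open>By submodularity, \<open>k\<close> adds nothing to
    \<open>insert i (insert j S)\<close> because it adds nothing to \<open>insert j S\<close>; and
    that larger set has the rank of \<open>insert i S\<close> because \<open>j\<close> is in
    \<open>cl i\<close>.\<close>
  have cl_subset: "cl j \<subseteq> cl i" if "i \<in> A" "j \<in> A" "j \<in> cl i" for i j
  proof
    fix k assume "k \<in> cl j"
    then show "k \<in> cl i"
      using that submod[of k i "insert j S"] mono[of "insert i S" k]
        mono[of "insert k (insert i S)" j]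
      by (simp add: A_def cl_def insert_commute)
  qed
  have cl_sym: "i \<in> cl j" if "i \<in> A" "j \<in> A" "j \<in> cl i" for i j
    using that by (simp add: A_def cl_def insert_commute)
  have self: "j \<in> cl j" for j
    by (simp add: cl_def)
  have cl_eq: "cl i = cl j \<longleftrightarrow> j \<in> cl i" if "i \<in> A" "j \<in> A" for i j
    using that cl_subset cl_sym self by (metis subset_antisym)
  \<comment> \<open>For two non-loops, adding both raises the rank by 1 if they are parallel and by
    2 if not, giving -1 or 0. A loop adds nothing after the other element either, by submodularity,
    so the terms cancel.\<close>
  have coeff: "real (?r (insert j (insert i S))) - real (?r (insert i S)) - real (?r (insert j S))
      + real (?r S) = (if i \<in> A \<and> j \<in> A \<and> cl i = cl j then -1 else 0)" for i j
  proof (cases "i \<in> A \<and> j \<in> A")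
    case True
    then have "?r (insert j (insert i S)) = (if j \<in> cl i then Suc (?r S) else Suc (Suc (?r S)))"
      using step[of j "insert i S"] mono[of "insert i S" j] by (auto simp: A_def cl_def)
    with True show ?thesis
      by (simp add: cl_eq A_def)
  next
    case False
    then show ?thesis
      using step[of i S] step[of j S] mono[of S i] mono[of S j] submod[of j i S]
        mono[of "insert i S" j] mono[of "insert j S" i]
      by (auto simp: A_def insert_commute)
  qed
  have "directional_difference d (directional_difference d (\<lambda>S. real (?r S))) S =
      (\<Sum>i\<in>UNIV. if i \<in> A then \<Sum>j\<in>UNIV. if j \<in> A then
          if cl i = cl j then - (d i * d j) else 0 else 0 else 0)"
    unfolding directional_difference_twice coeff
    by (intro sum.cong refl) (auto intro!: sum.cong)
  also have "\<dots> = (\<Sum>i\<in>A. \<Sum>j\<in>A. if cl i = cl j then - (d i * d j) else 0)"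
    by (simp flip: sum.inter_restrict)
  also have "\<dots> = - (\<Sum>i\<in>A. \<Sum>j\<in>A. if cl i = cl j then d i * d j else 0)"
    unfolding sum_negf[symmetric] by (intro sum.cong refl) auto
  also have "\<dots> \<le> 0"
    using kernel_quadratic_form_nonneg[of A cl d] by simp
  finally show ?thesis .
qed

lemma directional_difference_twice_matroid_rank_sum_nonpos:
  fixes d :: "'m::finite \<Rightarrow> real"
  assumes "matroid_rank_sum UNIV v"
  shows "directional_difference d (directional_difference d v) S \<le> 0"
proof -
  obtain \<kappa> :: nat and u :: "nat \<Rightarrow> 'm set \<Rightarrow> nat" and w :: "nat \<Rightarrow> real"
    where u: "\<And>l. l < \<kappa> \<Longrightarrow> matroid_rank_function UNIV (u l)"
      and w: "\<And>l. l < \<kappa> \<Longrightarrow> 0 \<le> w l"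
      and v: "\<And>S. v S = (\<Sum>l<\<kappa>. w l * real (u l S))"
    using assms unfolding matroid_rank_sum_def by auto
  have nonpos: "directional_difference d (directional_difference d (\<lambda>S. real (u l S))) S \<le> 0"
    if l: "l < \<kappa>" for l
  proof -
    obtain \<I> where \<I>: "matroid UNIV \<I>" "\<And>S. u l S = matroid_rank \<I> S"
      using u[OF l] by (auto simp: matroid_rank_function_def)
    show ?thesis
      unfolding \<I>(2) using \<I>(1) by (rule directional_difference_twice_matroid_rank_nonpos)
  qed
  have "directional_difference d (directional_difference d v) S =
      (\<Sum>l<\<kappa>. w l * directional_difference d (directional_difference d (\<lambda>S. real (u l S))) S)"
    unfolding v directional_difference_sum[abs_def] ..
  also have "\<dots> \<le> 0"
    using w nonpos by (intro sum_nonpos mult_nonneg_nonpos) auto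
  finally show ?thesis .
qed

section \<open>Expectation under independent Poisson rounding\<close>

text \<open>For nonnegative \<open>x\<close>, the probability that \<open>S\<close> is the set of
  items with at least one arrival, under independent Poisson arrivals with means
  \<open>x j\<close>.\<close>

definition poisson_weight :: "('m::finite \<Rightarrow> real) \<Rightarrow> 'm set \<Rightarrow> real" where
  "poisson_weight x S = (\<Prod>j\<in>UNIV. if j \<in> S then 1 - exp (- x j) else exp (- x j))"

text \<open>The multilinear extension of \<open>h\<close> at the point with coordinates
  \<open>1 - exp (- x j)\<close>.\<close>

definition poisson_extension :: "('m::finite set \<Rightarrow> real) \<Rightarrow> ('m \<Rightarrow> real) \<Rightarrow> real" where
  "poisson_extension h x = (\<Sum>S\<in>UNIV. h S * poisson_weight x S)"

lemma poisson_weight_nonneg: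
  assumes "\<And>j. 0 \<le> x j"
  shows "0 \<le> poisson_weight x S"
  unfolding poisson_weight_def using assms by (intro prod_nonneg) auto

lemma sum_UNIV_split_member:
  fixes f :: "'m::finite set \<Rightarrow> real"
  shows "(\<Sum>S\<in>UNIV. f S) = (\<Sum>S | i \<notin> S. f S + f (insert i S))"
proof -
  have "(\<Sum>S\<in>UNIV. f S) = (\<Sum>S | i \<notin> S. f S) + (\<Sum>S | i \<in> S. f S)"
    by (subst sum.union_disjoint[symmetric]) (auto intro!: sum.cong)
  also have "(\<Sum>S | i \<in> S. f S) = (\<Sum>S | i \<notin> S. f (insert i S))"
    by (rule sum.reindex_bij_witness[of _ "insert i" "\<lambda>S. S - {i}"]) (auto simp: insert_absorb)
  finally show ?thesis
    by (simp add: sum.distrib)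
qed

text \<open>Up to sign, the factor of \<open>i\<close> has derivative \<open>exp (- x i)\<close> in
  its own rate, which is the factor of an absent \<open>i\<close>. So each partial derivative is
  again a weight up to sign.\<close>

lemma poisson_weight_has_derivative:
  fixes x d :: "'m::finite \<Rightarrow> real"
  shows "((\<lambda>t. poisson_weight (\<lambda>j. x j + t * d j) S) has_real_derivative
     (\<Sum>i\<in>UNIV. d i * (if i \<in> S then poisson_weight (\<lambda>j. x j + t * d j) (S - {i})
        else - poisson_weight (\<lambda>j. x j + t * d j) S))) (at t)"
proof -
  let ?p = "\<lambda>t S j. if j \<in> S then 1 - exp (- (x j + t * d j)) else exp (- (x j + t * d j))"
  let ?p' = "\<lambda>j. if j \<in> S then d j * exp (- (x j + t * d j)) else - (d j * exp (- (x j + t * d j)))"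
  have deriv: "((\<lambda>t. poisson_weight (\<lambda>j. x j + t * d j) S) has_real_derivative
      (\<Sum>i\<in>UNIV. ?p' i * (\<Prod>j\<in>UNIV - {i}. ?p t S j))) (at t)"
    unfolding poisson_weight_def
    by (rule has_field_derivative_prod) (auto intro!: derivative_eq_intros)
  have "?p' i * (\<Prod>j\<in>UNIV - {i}. ?p t S j) =
      d i * (if i \<in> S then poisson_weight (\<lambda>j. x j + t * d j) (S - {i})
        else - poisson_weight (\<lambda>j. x j + t * d j) S)" for i
  proof -
    have "(\<Prod>j\<in>UNIV - {i}. ?p t (S - {i}) j) = (\<Prod>j\<in>UNIV - {i}. ?p t S j)"
      by (intro prod.cong) auto
    then have "poisson_weight (\<lambda>j. x j + t * d j) (S - {i}) =
        exp (- (x i + t * d i)) * (\<Prod>j\<in>UNIV - {i}. ?p t S j)"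
      unfolding poisson_weight_def by (subst prod.remove[of _ i]) simp_all
    then show ?thesis
      by (cases "i \<in> S") simp_all
  qed
  with deriv show ?thesis
    by simp
qed

lemma poisson_extension_has_derivative:
  fixes x d :: "'m::finite \<Rightarrow> real"
  shows "((\<lambda>t. poisson_extension h (\<lambda>j. x j + t * d j)) has_real_derivative
     poisson_extension (directional_difference d h) (\<lambda>j. x j + t * d j)) (at t)"
proof -
  let ?P = "poisson_weight (\<lambda>j. x j + t * d j)"
  let ?P' = "\<lambda>i S. if i \<in> S then ?P (S - {i}) else - ?P S"
  have "((\<lambda>t. poisson_extension h (\<lambda>j. x j + t * d j)) has_real_derivative
      (\<Sum>S\<in>UNIV. h S * (\<Sum>i\<in>UNIV. d i * ?P' i S))) (at t)"
    unfolding poisson_extension_def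
    by (intro DERIV_sum DERIV_cmult poisson_weight_has_derivative)
  also have "(\<Sum>S\<in>UNIV. h S * (\<Sum>i\<in>UNIV. d i * ?P' i S)) =
      (\<Sum>i\<in>UNIV. d i * (\<Sum>S\<in>UNIV. h S * ?P' i S))"
    unfolding sum_distrib_left by (subst sum.swap) (simp add: mult.left_commute)
  also have "\<dots> = (\<Sum>i\<in>UNIV. d i * (\<Sum>S\<in>UNIV. (h (insert i S) - h S) * ?P S))"
  proof -
    \<comment> \<open>Summation by parts: pair each \<open>S\<close> avoiding \<open>i\<close> with
      \<open>insert i S\<close>. On the left the pair contributes
      \<open>(h (insert i S) - h S) * ?P S\<close>; on the right \<open>S\<close> contributes this
      alone, as the difference vanishes at \<open>insert i S\<close>.\<close>
    have "(\<Sum>S\<in>UNIV. h S * ?P' i S) = (\<Sum>S\<in>UNIV. (h (insert i S) - h S) * ?P S)" for i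
      by (subst (1 2) sum_UNIV_split_member[of _ i]) (auto simp: algebra_simps intro!: sum.cong)
    then show ?thesis
      by simp
  qed
  also have "\<dots> = poisson_extension (directional_difference d h) (\<lambda>j. x j + t * d j)"
    unfolding poisson_extension_def directional_difference_def sum_distrib_left sum_distrib_right
    by (subst sum.swap) (simp add: mult.assoc)
  finally show ?thesis .
qed

lemma poisson_extension_concave:
  fixes x y :: "'m::finite \<Rightarrow> real"
  assumes "\<And>d S. directional_difference d (directional_difference d h) S \<le> 0"
    and "\<And>j. 0 \<le> x j" "\<And>j. 0 \<le> y j" and "0 \<le> a" "0 \<le> b" "a + b = 1"
  shows "a * poisson_extension h x + b * poisson_extension h y
       \<le> poisson_extension h (\<lambda>j. a * x j + b * y j)"
proof -
  let ?d = "\<lambda>j. y j - x j"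
  let ?g = "\<lambda>h t. poisson_extension h (\<lambda>j. x j + t * ?d j)"
  have "concave_on {0..1} (?g h)"
  proof (rule f''_le0_imp_concave)
    fix t :: real
    assume t: "t \<in> {0..1}"
    show "(?g h has_real_derivative ?g (directional_difference ?d h) t) (at t)"
      and "(?g (directional_difference ?d h) has_real_derivative
        ?g (directional_difference ?d (directional_difference ?d h)) t) (at t)"
      by (rule poisson_extension_has_derivative)+
    \<comment> \<open>Nonnegative rates along the segment make the weights nonnegative, so the
      second derivative inherits the sign of the second differences.\<close>
    have "0 \<le> x j + t * ?d j" for j
    proof -
      have "x j + t * ?d j = (1 - t) * x j + t * y j"
        by (simp add: algebra_simps)
      with t assms(2,3) show ?thesis
        by simp
    qed
    then show "?g (directional_difference ?d (directional_difference ?d h)) t \<le> 0"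
      unfolding poisson_extension_def
      using assms(1) by (intro sum_nonpos mult_nonpos_nonneg poisson_weight_nonneg)
  qed simp
  moreover have "a = 1 - b" "b \<le> 1"
    using assms(4-6) by simp_all
  ultimately have "a * ?g h 0 + b * ?g h 1 \<le> ?g h b"
    using assms(5) concave_onD[of "{0..1}" "?g h" b 0 1] by simp
  moreover have "x j + b * ?d j = a * x j + b * y j" for j
    using assms(6) by (simp add: algebra_simps flip: distrib_right)
  ultimately show ?thesis
    by simp
qed

section \<open>Marginals of the random allocation and concavity\<close>

lemma pmf_poisson_rounding_component:
  fixes x :: "real ^ 'm::finite ^ 'n::finite"
  assumes "x \<in> fractional_allocations"
  shows "pmf (map_pmf (\<lambda>S. S i) (poisson_rounding x)) T = poisson_weight (\<lambda>j. x $ i $ j) T"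
proof -
  \<comment> \<open>\<open>B j\<close> collects the recipients of \<open>j\<close> compatible with
    player \<open>i\<close> winning exactly \<open>T\<close>; outside \<open>T\<close> these are
    \<open>None\<close> and all other players. The event is thus a product over the independently
    assigned items.\<close>
  define B where "B j = (if j \<in> T then {Some i} else - {Some i})" for j
  have "(\<lambda>\<sigma>. {j. \<sigma> j = Some i}) -` {T} = Pi UNIV B"
    by (auto simp: B_def Pi_iff split: if_splits)
  then have "pmf (map_pmf (\<lambda>S. S i) (poisson_rounding x)) T =
      measure_pmf.prob (Pi_pmf UNIV None (poisson_item x)) (Pi UNIV B)"
    unfolding poisson_rounding_def pmf.map_comp o_def pmf_map by simp
  also have "\<dots> = (\<Prod>j\<in>UNIV. measure_pmf.prob (poisson_item x j) (B j))"
    by (rule measure_Pi_pmf_Pi) simp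
  also have "\<dots> = poisson_weight (\<lambda>j. x $ i $ j) T"
    unfolding poisson_weight_def
    by (intro prod.cong refl)
      (simp add: B_def measure_pmf_single pmf_poisson_item[OF assms]
        measure_pmf.prob_compl[where A = "{_}", simplified, folded Compl_eq_Diff_UNIV])
  finally show ?thesis .
qed

text \<open>By linearity only the law of each \<open>S i\<close> matters, so the dependence between
  the players' sets drops out.\<close>

lemma expectation_poisson_rounding:
  fixes x :: "real ^ 'm::finite ^ 'n::finite"
  assumes "x \<in> fractional_allocations"
  shows "measure_pmf.expectation (poisson_rounding x) (\<lambda>S. \<Sum>i\<in>UNIV. v i (S i)) =
    (\<Sum>i\<in>UNIV. poisson_extension (v i) (\<lambda>j. x $ i $ j))"
proof -
  have "measure_pmf.expectation (poisson_rounding x) (\<lambda>S. \<Sum>i\<in>UNIV. v i (S i)) =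
      (\<Sum>i\<in>UNIV. measure_pmf.expectation (poisson_rounding x) (\<lambda>S. v i (S i)))"
    by (intro Bochner_Integration.integral_sum integrable_measure_pmf_finite) simp
  also have "\<dots> = (\<Sum>i\<in>UNIV. measure_pmf.expectation (map_pmf (\<lambda>S. S i) (poisson_rounding x)) (v i))"
    by simp
  also have "\<dots> = (\<Sum>i\<in>UNIV. poisson_extension (v i) (\<lambda>j. x $ i $ j))"
    unfolding poisson_extension_def pmf_poisson_rounding_component[OF assms, symmetric]
    by (intro sum.cong refl integral_measure_pmf_real) auto
  finally show ?thesis .
qed

lemma convex_fractional_allocations: "convex (fractional_allocations :: (real ^ 'm ^ 'n::finite) set)"
proof (rule convexI)
  fix x y :: "real ^ 'm ^ 'n" and a b :: real
  assume xy: "x \<in> fractional_allocations" "y \<in> fractional_allocations"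
    and ab: "0 \<le> a" "0 \<le> b" "a + b = 1"
  have le: "a * s + b * t \<le> 1" if "s \<le> 1" "t \<le> 1" for s t
    using convex_bound_le[OF that ab] .
  have "(\<Sum>i\<in>UNIV. a * x $ i $ j + b * y $ i $ j) \<le> 1" for j
    using xy le by (simp add: sum.distrib fractional_allocations_def flip: sum_distrib_left)
  with xy ab le show "a *\<^sub>R x + b *\<^sub>R y \<in> fractional_allocations"
    by (simp add: fractional_allocations_def)
qed

theorem lemma4p2:
  fixes v :: "'n::finite \<Rightarrow> 'm::finite set \<Rightarrow> real"
  assumes "\<And>i. matroid_rank_sum UNIV (v i)"
  shows "concave_on (fractional_allocations :: (real ^ 'm ^ 'n) set)
           (\<lambda>x. measure_pmf.expectation (poisson_rounding x) (\<lambda>S. \<Sum>i\<in>UNIV. v i (S i)))"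
  unfolding concave_on_iff
proof (intro conjI ballI allI impI)
  show convex: "convex (fractional_allocations :: (real ^ 'm ^ 'n) set)"
    by (rule convex_fractional_allocations)
  fix x y :: "real ^ 'm ^ 'n" and a b :: real
  assume xy: "x \<in> fractional_allocations" "y \<in> fractional_allocations"
    and ab: "0 \<le> a" "0 \<le> b" "a + b = 1"
  \<comment> \<open>The marginal formula is available only on \<open>fractional_allocations\<close>,
    so the convex combination must be shown to stay there.\<close>
  have z: "a *\<^sub>R x + b *\<^sub>R y \<in> fractional_allocations"
    using convex xy ab by (rule convexD)
  have "a * poisson_extension (v i) (\<lambda>j. x $ i $ j) + b * poisson_extension (v i) (\<lambda>j. y $ i $ j)
      \<le> poisson_extension (v i) (\<lambda>j. (a *\<^sub>R x + b *\<^sub>R y) $ i $ j)" for i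
    using poisson_extension_concave[OF
        directional_difference_twice_matroid_rank_sum_nonpos[OF assms] _ _ ab,
        of "\<lambda>j. x $ i $ j" "\<lambda>j. y $ i $ j"] xy
    by (simp add: fractional_allocations_def)
  then show "a * measure_pmf.expectation (poisson_rounding x) (\<lambda>S. \<Sum>i\<in>UNIV. v i (S i)) +
      b * measure_pmf.expectation (poisson_rounding y) (\<lambda>S. \<Sum>i\<in>UNIV. v i (S i))
      \<le> measure_pmf.expectation (poisson_rounding (a *\<^sub>R x + b *\<^sub>R y)) (\<lambda>S. \<Sum>i\<in>UNIV. v i (S i))"
    unfolding expectation_poisson_rounding[OF xy(1)] expectation_poisson_rounding[OF xy(2)]
      expectation_poisson_rounding[OF z] sum_distrib_left sum.distrib[symmetric]
    by (intro sum_mono)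
qed

end
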